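(* There exist an absolute constant $c>0$ and an integer $n_0$ such that the following holds for every $n\ge n_0$: if $\gamma,\Delta\ge 1$ are such that $\textsc{Online-Sorting}[\gamma,n]$ admits a $\Delta$-competitive online algorithm, then \[\gamma\Delta\ \ge\ c\cdot \frac{\log n}{\log\log n}.\] That is, $\gamma\Delta=\Omega(\log n/\log\log n)$.
   Context: $\textsc{Online-Sorting}[\gamma,n]$ (for $\gamma\ge 1$): there is an array $A$ consisting of $\gamma n$ initially empty cells, ordered from left to right. A stream of $n$ reals $s_1,\dots,s_n\in[0,1]$ arrives one at a time (the stream may be chosen adaptively by an adversary depending on the algorithm's previous decisions). An online algorithm must place each $s_i$ into an empty cell of $A$, irrevocably, before $s_{i+1}$ is revealed. After all $n$ reals are placed, let $r_1,\dots,r_n$ be the reals in their left-to-right order in $A$, and set $r_0:=0$, $r_{n+1}:=1$. The cost is $\sum_{i=0}^{n}|r_{i+1}-r_i|$. The offline optimum (placing the reals in sorted order) has cost exactly $1$. An online algorithm is $\Delta$-competitive if its cost is at most $\Delta$ on every stream of $n$ reals in $[0,1]$. *)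

theory Defs
  imports Complex_Main
begin

text \<open>A deterministic online algorithm is a map from the stream prefix
  [s_1,...,s_i] (including the current real s_i) to the cell (index, 0-based,
  counted left to right) into which s_i is placed. Because it sees only the
  prefix, its decisions are online and irrevocable.\<close>
type_synonym online_alg = "real list \<Rightarrow> nat"

definition place :: "online_alg \<Rightarrow> real list \<Rightarrow> nat \<Rightarrow> nat" where
  "place A xs i = A (take (Suc i) xs)"

definition num_cells :: "real \<Rightarrow> nat \<Rightarrow> nat" where
  "num_cells \<gamma> n = nat \<lfloor>\<gamma> * real n\<rfloor>"

definition valid_run :: "online_alg \<Rightarrow> nat \<Rightarrow> real list \<Rightarrow> bool" where
  "valid_run A m xs \<longleftrightarrow>
     (\<forall>i<length xs. place A xs i < m) \<and> inj_on (place A xs) {..<length xs}"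

definition path_cost :: "real list \<Rightarrow> real" where
  "path_cost rs = (\<Sum>(a, b) \<leftarrow> zip rs (tl rs). \<bar>b - a\<bar>)"

text \<open>Cost of the final array: the reals read left to right, with r_0 = 0
  and r_{n+1} = 1 appended.\<close>
definition run_cost :: "online_alg \<Rightarrow> real list \<Rightarrow> real" where
  "run_cost A xs =
     path_cost (0 # map (\<lambda>i. xs ! i) (sort_key (place A xs) [0..<length xs]) @ [1])"

definition admits_competitive :: "real \<Rightarrow> nat \<Rightarrow> real \<Rightarrow> bool" where
  "admits_competitive \<gamma> n \<Delta> \<longleftrightarrow>
     (\<exists>A :: online_alg. \<forall>xs. length xs = n \<and> set xs \<subseteq> {0..1} \<longrightarrow>
        valid_run A (num_cells \<gamma> n) xs \<and> run_cost A xs \<le> \<Delta>)"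

end

(* The adversary proceeds in T ~ log n / log log n phases, from fine to coarse
   scales.  In a phase with resolution 1/J it presents J equally spaced reals,
   each about n/(TJ) times, J shrinking by a factor polynomial in T from phase to
   phase.  A random shift of the reals ensures that few empty cells of short or
   medium gaps lie next to a cell holding a nearby real.  A short gap cannot take
   many copies, and if it is not near, using it costs much; a medium gap that is
   not near costs about 1/(gamma J); and there are few long gaps both before and
   after the phase, so most path pieces created inside long gaps lie in gaps that
   have become too short to be of use later on.  Hence the potential

     cost + cost carried by short gaps + c * (cells in short gaps),

   where "short" is measured at the current scale, grows by a constant multiple
   of 1/gamma in every phase.  It never exceeds 2 Delta + O(T/gamma). *)

theory Submission
  imports Defs
begin

subsection \<open>Gaps between occupied cells\<close>

text \<open>Adjacent occupied cells also form a pair, of length 1, although no empty cell lies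
  between them. Thus the pairs tile \<open>{x..y}\<close> whenever both ends lie in
  \<open>D\<close>.\<close>

definition seg :: "nat set \<Rightarrow> nat \<Rightarrow> nat \<Rightarrow> (nat \<times> nat) set" where
  "seg D x y = {(u, v). u \<in> D \<and> v \<in> D \<and> u < v \<and> x \<le> u \<and> v \<le> y \<and> D \<inter> {u<..<v} = {}}"

definition seg_sum :: "(nat \<Rightarrow> nat \<Rightarrow> real) \<Rightarrow> nat set \<Rightarrow> nat \<Rightarrow> nat \<Rightarrow> real" where
  "seg_sum h D x y = (\<Sum>(u, v)\<in>seg D x y. h u v)"

lemma segD:
  assumes "(u, v) \<in> seg D x y"
  shows "u \<in> D" "v \<in> D" "u < v" "x \<le> u" "v \<le> y" "D \<inter> {u<..<v} = {}"
  using assms by (auto simp: seg_def)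

lemma finite_seg [simp]: "finite (seg D x y)"
  by (rule finite_subset[of _ "{x..y} \<times> {x..y}"]) (auto simp: seg_def)

lemma seg_self [simp]: "seg D x x = {}"
  by (auto simp: seg_def)

lemma seg_sum_self [simp]: "seg_sum h D x x = 0"
  by (simp add: seg_sum_def)

lemma seg_cong: "D \<inter> {x..y} = D' \<inter> {x..y} \<Longrightarrow> seg D x y = seg D' x y"
proof -
  have *: "seg E x y = seg (E \<inter> {x..y}) x y" for E
    by (auto simp: seg_def)
  show "D \<inter> {x..y} = D' \<inter> {x..y} \<Longrightarrow> seg D x y = seg D' x y"
    using *[of D] *[of D'] by simp
qed

lemma seg_step:
  assumes "x \<in> D" "z \<in> D" "x < z" "z \<le> y" "D \<inter> {x<..<z} = {}"
  shows "seg D x y = insert (x, z) (seg D z y)"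
proof (intro equalityI subsetI)
  fix p assume "p \<in> seg D x y"
  then obtain u v where p: "p = (u, v)" and uv: "(u, v) \<in> seg D x y"
    by (cases p) auto
  note d = segD[OF uv]
  show "p \<in> insert (x, z) (seg D z y)"
  proof (cases "u = x")
    case True
    have "v = z"
      using d assms True by (metis disjoint_iff greaterThanLessThan_iff linorder_neqE_nat)
    then show ?thesis using True p by simp
  next
    case False
    then have "z \<le> u"
      using d assms by (metis disjoint_iff greaterThanLessThan_iff le_neq_implies_less not_le)
    then show ?thesis using d p by (auto simp: seg_def)
  qed
next
  fix p assume "p \<in> insert (x, z) (seg D z y)"
  then show "p \<in> seg D x y" using assms by (auto simp: seg_def)
qed

lemma seg_sum_step:
  assumes "x \<in> D" "z \<in> D" "x < z" "z \<le> y" "D \<inter> {x<..<z} = {}"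
  shows "seg_sum h D x y = h x z + seg_sum h D z y"
proof -
  have "(x, z) \<notin> seg D z y" using assms by (auto simp: seg_def)
  then show ?thesis unfolding seg_sum_def seg_step[OF assms] by simp
qed

text \<open>Peels off the leftmost gap while the right end \<open>y\<close> stays fixed, in line
  with \<open>seg_sum_step\<close>, so that facts on gap sums become one-step inductions.\<close>

lemma seg_induct [consumes 3, case_names last step]:
  assumes "x \<in> D" "y \<in> D" "x \<le> (y::nat)"
    and "P y"
    and "\<And>x z. x \<in> D \<Longrightarrow> z \<in> D \<Longrightarrow> x < z \<Longrightarrow> z \<le> y \<Longrightarrow> D \<inter> {x<..<z} = {} \<Longrightarrow> P z \<Longrightarrow> P x"
  shows "P x"
  using assms(1,3)
proof (induction "y - x" arbitrary: x rule: less_induct)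
  case less
  show ?case
  proof (cases "x = y")
    case True
    then show ?thesis using assms(4) by simp
  next
    case False
    let ?z = "LEAST z. z \<in> D \<and> x < z"
    have ex: "y \<in> D \<and> x < y" using False less assms(2) by auto
    have z: "?z \<in> D \<and> x < ?z" by (rule LeastI[of _ y]) (rule ex)
    have zy: "?z \<le> y" by (rule Least_le) (rule ex)
    have e: "D \<inter> {x<..<?z} = {}" using not_less_Least by fastforce
    have "y - ?z < y - x" using z zy by linarith
    then have "P ?z" using less.hyps[of ?z] z zy by blast
    then show ?thesis using assms(5)[of x ?z] z zy e less.prems by blast
  qed
qed

lemma seg_sum_add:
  assumes "x \<in> D" "y \<in> D" "x \<le> y" "y \<le> w"
  shows "seg_sum h D x w = seg_sum h D x y + seg_sum h D y w"
  using assms(1-3)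
proof (induction rule: seg_induct)
  case (step x z)
  then show ?case using assms(4) seg_sum_step[of x D z w h] seg_sum_step[of x D z y h] by simp
qed simp

text \<open>Adding cells only subdivides gaps, so the new sum can be grouped by old gaps. This is
  what allows potentials before and after a phase to be compared gap by gap.\<close>

lemma seg_sum_refine:
  assumes "D \<subseteq> D'" "x \<in> D" "y \<in> D" "x \<le> y"
  shows "seg_sum h D' x y = seg_sum (seg_sum h D') D x y"
  using assms(2-4)
proof (induction rule: seg_induct)
  case (step x z)
  then show ?case
    using seg_sum_step[of x D z y "seg_sum h D'"] seg_sum_add[of x D' z y h] assms(1) by auto
qed simp

lemma seg_sum_mono:
  assumes "\<And>u v. (u, v) \<in> seg D x y \<Longrightarrow> h u v \<le> h' u v"
  shows "seg_sum h D x y \<le> seg_sum h' D x y"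
  unfolding seg_sum_def by (rule sum_mono) (use assms in auto)

lemma seg_sum_cong:
  assumes "\<And>u v. (u, v) \<in> seg D x y \<Longrightarrow> h u v = h' u v"
  shows "seg_sum h D x y = seg_sum h' D x y"
  unfolding seg_sum_def by (rule sum.cong) (use assms in auto)

lemma seg_sum_nonneg:
  assumes "\<And>u v. (u, v) \<in> seg D x y \<Longrightarrow> 0 \<le> h u v"
  shows "0 \<le> seg_sum h D x y"
  unfolding seg_sum_def by (rule sum_nonneg) (use assms in auto)

lemma seg_sum_plus: "seg_sum (\<lambda>u v. h u v + h' u v) D x y = seg_sum h D x y + seg_sum h' D x y"
  unfolding seg_sum_def by (simp add: sum.distrib case_prod_unfold)

lemma seg_sum_cmult: "seg_sum (\<lambda>u v. c * h u v) D x y = c * seg_sum h D x y"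
  unfolding seg_sum_def by (simp add: sum_distrib_left case_prod_unfold)

lemma seg_sum_length:
  assumes "x \<in> D" "y \<in> D" "x \<le> y"
  shows "seg_sum (\<lambda>u v. real (v - u)) D x y = real (y - x)"
  using assms
proof (induction rule: seg_induct)
  case (step x z)
  then show ?case using seg_sum_step[of x D z y "\<lambda>u v. real (v - u)"] by auto
qed simp

text \<open>Assigns each newly filled cell to the old gap that contains it.\<close>

lemma seg_exists:
  assumes "x \<in> D" "y \<in> D" "x \<le> y" "x \<le> z" "z \<le> y" "z \<notin> D"
  shows "\<exists>u v. (u, v) \<in> seg D x y \<and> u < z \<and> z < v"
  using assms
proof (induction rule: seg_induct)
  case last
  then have "y = z" by simp
  then show ?case using last.prems assms(2) by blast
next
  case (step x w)
  have sg: "seg D x y = insert (x, w) (seg D w y)"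
    using step.hyps by (rule seg_step)
  show ?case
  proof (cases "w \<le> z")
    case True
    then obtain u v where "(u, v) \<in> seg D w y" "u < z" "z < v"
      using step.IH step.prems by blast
    then show ?thesis unfolding sg by blast
  next
    case False
    have "x < z" using step.hyps(1) step.prems by (metis le_neq_implies_less)
    then show ?thesis unfolding sg using False by (meson insertI1 not_le)
  qed
qed

section \<open>Path length and the number of separated points visited\<close>

abbreviation step_len :: "(nat \<Rightarrow> real) \<Rightarrow> nat \<Rightarrow> nat \<Rightarrow> real" where
  "step_len f u v \<equiv> \<bar>f v - f u\<bar>"

lemma step_len_le_seg_sum:
  assumes "x \<in> D" "y \<in> D" "x \<le> y"
  shows "\<bar>f y - f x\<bar> \<le> seg_sum (step_len f) D x y"
  using assms
proof (induction rule: seg_induct)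
  case (step x z)
  then show ?case using seg_sum_step[of x D z y "step_len f"] by auto
qed simp

lemma step_len_mid_le_seg_sum:
  assumes "x \<in> D" "y \<in> D" "z \<in> D" "x \<le> z" "z \<le> y"
  shows "\<bar>f z - f x\<bar> \<le> seg_sum (step_len f) D x y"
  using step_len_le_seg_sum[of x D z f] step_len_le_seg_sum[of z D y f]
    seg_sum_add[of x D z y "step_len f"] assms by linarith

text \<open>Moving between distinct points of \<open>P\<close> costs at least \<open>s\<close>.
  Pieces of length at least \<open>\<theta>\<close> are charged a flat \<open>s\<close> instead of
  their own cost, because the gain of a long gap sees only its short pieces; the flat charges are
  later paid by length.\<close>

lemma card_visited_le:
  fixes \<theta> s :: real
  assumes "x \<in> D" "y \<in> D" "x \<le> y"
    and "finite P" "0 < s"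
    and sep: "\<And>p q. p \<in> P \<Longrightarrow> q \<in> P \<Longrightarrow> p \<noteq> q \<Longrightarrow> s \<le> \<bar>p - q\<bar>"
  shows "s * real (card (P \<inter> f ` (D \<inter> {x..y})))
     \<le> s + seg_sum (\<lambda>u v. if real (v - u) < \<theta> then \<bar>f v - f u\<bar> else s) D x y"
proof -
  define V where "V = (\<lambda>x. P \<inter> f ` (D \<inter> {x..y}))"
  define k where "k = (\<lambda>u v. if real (v - u) < \<theta> then \<bar>f v - f u\<bar> else s)"
  have finV: "finite (V x)" for x using assms(4) by (auto simp: V_def)
  txt \<open>The slack \<open>d\<close> records how far the path still is from the visited points.\<close>
  define d where "d = (\<lambda>x. Min (insert s ((\<lambda>p. \<bar>f x - p\<bar>) ` V x)))"
  have d_le: "d x \<le> s" "\<And>p. p \<in> V x \<Longrightarrow> d x \<le> \<bar>f x - p\<bar>" for x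
    unfolding d_def using finV by (auto intro!: Min_le)
  have d_cases: "d x = s \<or> (\<exists>p\<in>V x. d x = \<bar>f x - p\<bar>)" for x
    using Min_in[of "insert s ((\<lambda>p. \<bar>f x - p\<bar>) ` V x)"] finV unfolding d_def by auto
  have d0: "0 \<le> d x" for x using d_cases[of x] assms(5) by auto
  \<comment> \<open>The cap at \<open>s\<close> gives \<open>d\<close> a value while no point of
    \<open>P\<close> has been visited, and lets a piece charged \<open>s\<close> cover any change of
    \<open>d\<close>.\<close>
  have "s * real (card (V x)) + d x \<le> s + seg_sum k D x y"
    using assms(1-3)
  proof (induction rule: seg_induct)
    case last
    show ?case
    proof (cases "f y \<in> P")
      case True
      then have V: "V y = {f y}" using assms(2) by (auto simp: V_def)
      then have "d y \<le> 0" using d_le(2)[of "f y" y] by simp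
      then show ?thesis using V by simp
    next
      case False
      then have "V y = {}" by (auto simp: V_def)
      then show ?thesis using d_le(1)[of y] by simp
    qed
  next
    case (step x z)
    have k: "seg_sum k D x y = k x z + seg_sum k D z y"
      using step by (intro seg_sum_step)
    have "w = x \<or> z \<le> w" if "w \<in> D" "x \<le> w" for w
    proof (rule ccontr)
      assume "\<not> (w = x \<or> z \<le> w)"
      then have "w \<in> D \<inter> {x<..<z}" using that by auto
      then show False using step.hyps by simp
    qed
    then have "D \<inter> {x..y} = insert x (D \<inter> {z..y})"
      using step.hyps(1,3,4) by (intro set_eqI) (smt (verit) Int_iff atLeastAtMost_iff insert_iff le_trans less_imp_le_nat order_refl)
    then have V: "V x = (if f x \<in> P then insert (f x) (V z) else V z)"
      by (auto simp: V_def)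
    show ?case
    proof (cases "f x \<in> P \<and> f x \<notin> V z")
      case True
      then have Vx: "V x = insert (f x) (V z)" "card (V x) = Suc (card (V z))"
        using V finV by auto
      have "d x \<le> 0" using d_le(2)[of "f x" x] Vx by simp
      \<comment> \<open>A fresh point is at distance at least \<open>s\<close> from every visited
        one, so the piece to \<open>z\<close> and the slack left at \<open>z\<close> together pay
        for it.\<close>
      moreover have "s \<le> k x z + d z"
      proof (cases "real (z - x) < \<theta>")
        case t: True
        from d_cases[of z] show ?thesis
        proof
          assume "\<exists>p\<in>V z. d z = \<bar>f z - p\<bar>"
          then obtain p where p: "p \<in> V z" "d z = \<bar>f z - p\<bar>" by blast
          then have "s \<le> \<bar>f x - p\<bar>" using True sep[of "f x" p] by (auto simp: V_def)
          then show ?thesis using p t by (auto simp: k_def)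
        qed (auto simp: k_def t)
      qed (use d0[of z] in \<open>auto simp: k_def\<close>)
      ultimately show ?thesis using step.IH k Vx by (simp add: algebra_simps)
    next
      case False
      then have Vx: "V x = V z" using V by auto
      have "d x \<le> k x z + d z"
      proof (cases "real (z - x) < \<theta>")
        case t: True
        from d_cases[of z] show ?thesis
        proof
          assume "\<exists>p\<in>V z. d z = \<bar>f z - p\<bar>"
          then obtain p where p: "p \<in> V z" "d z = \<bar>f z - p\<bar>" by blast
          then have "d x \<le> \<bar>f x - p\<bar>" using d_le(2) Vx by blast
          then show ?thesis using p t by (auto simp: k_def)
        qed (use d_le(1)[of x] in \<open>auto simp: k_def t\<close>)
      qed (use d0[of z] d_le(1)[of x] in \<open>auto simp: k_def\<close>)
      then show ?thesis using step.IH k Vx by simp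
    qed
  qed
  then show ?thesis using d0[of x] unfolding V_def k_def by linarith
qed

subsection \<open>The potential\<close>

text \<open>Gap lengths are differences of cell numbers, one more than the number of
  empty cells. Summed over all gaps this weight is the potential.\<close>
definition gap_weight :: "real \<Rightarrow> real \<Rightarrow> (nat \<Rightarrow> real) \<Rightarrow> nat \<Rightarrow> nat \<Rightarrow> real" where
  "gap_weight \<theta> c f u v =
     \<bar>f v - f u\<bar> + (if real (v - u) < \<theta> then \<bar>f v - f u\<bar> + c * real (v - u) else 0)"

text \<open>Each piece of a short gap is short, so every cost counts twice and the lengths
  telescope.\<close>

lemma seg_sum_gap_weight_short:
  assumes "u \<in> D" "v \<in> D" "u \<le> v" "real (v - u) < \<theta>"
  shows "seg_sum (gap_weight \<theta> c f) D u v = 2 * seg_sum (step_len f) D u v + c * real (v - u)"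
proof -
  have "seg_sum (gap_weight \<theta> c f) D u v
      = seg_sum (\<lambda>a b. 2 * step_len f a b + c * real (b - a)) D u v"
  proof (rule seg_sum_cong)
    fix a b assume "(a, b) \<in> seg D u v"
    from segD[OF this] have "b - a \<le> v - u" by linarith
    then show "gap_weight \<theta> c f a b = 2 * step_len f a b + c * real (b - a)"
      using assms(4) by (simp add: gap_weight_def)
  qed
  then show ?thesis
    using seg_sum_length[OF assms(1-3)] by (simp add: seg_sum_plus seg_sum_cmult)
qed

text \<open>Dropping the length part leaves the path cost and a second copy of the cost of the short
  pieces. That second copy pays for the points visited inside a long gap.\<close>

lemma seg_sum_gap_weight_long:
  assumes "0 \<le> c"
  shows "seg_sum (step_len f) D u v
      + seg_sum (\<lambda>a b. if real (b - a) < \<theta> then \<bar>f b - f a\<bar> else 0) D u v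
    \<le> seg_sum (gap_weight \<theta> c f) D u v"
  unfolding seg_sum_plus[symmetric]
  by (rule seg_sum_mono) (use assms in \<open>auto simp: gap_weight_def\<close>)

text \<open>Neither filling cells nor raising the threshold lowers the potential: by the triangle
  inequality the pieces cost at least as much as the gap, and the pieces of a short gap keep its
  whole length weight.\<close>

lemma gap_weight_mono:
  assumes "u \<in> D" "v \<in> D" "u < v" "0 \<le> c" "\<theta> \<le> \<theta>'"
  shows "gap_weight \<theta> c f u v \<le> seg_sum (gap_weight \<theta>' c f) D u v"
proof (cases "real (v - u) < \<theta>")
  case True
  then show ?thesis
    using seg_sum_gap_weight_short[of u D v \<theta>' c f] step_len_le_seg_sum[of u D v f] assms
    by (simp add: gap_weight_def)
next
  case False
  have "0 \<le> seg_sum (\<lambda>a b. if real (b - a) < \<theta>' then \<bar>f b - f a\<bar> else 0) D u v"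
    by (rule seg_sum_nonneg) auto
  then show ?thesis
    using False seg_sum_gap_weight_long[OF assms(4), of f D u v \<theta>'] step_len_le_seg_sum[of u D v f] assms
    by (simp add: gap_weight_def)
qed


text \<open>A gap is short below \<open>\<theta>\<close>, medium between \<open>\<theta>\<close> and \<open>\<theta>'\<close>, long otherwise. If some copy of
  a point goes to a long gap or to a medium gap that is not near, the point is charged to the gain
  of that gap (or to the few long gaps). All \<open>m\<close> copies of any other point must share the near gaps,
  of total size \<open>B\<close>, and the short gaps crossed at cost at least \<open>r1\<close>, of which there are at most
  \<open>\<Delta> / r1\<close>.\<close>
lemma card_points_le:
  fixes \<theta> \<theta>' s c r1 r2 m B \<Delta> :: real
  assumes D: "0 \<in> D" "M \<in> D" "D \<subseteq> D'" "D' \<subseteq> {0..M}"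
    and P: "finite P" "\<And>p q. p \<in> P \<Longrightarrow> q \<in> P \<Longrightarrow> p \<noteq> q \<Longrightarrow> s \<le> \<bar>p - q\<bar>"
    and pos: "0 < s" "0 \<le> c" "0 < \<theta>" "\<theta> \<le> \<theta>'" "0 < r1" "0 < r2" "r2 \<le> s" "0 < m"
    and copies: "\<And>p. p \<in> P \<Longrightarrow> m \<le> real (card {z \<in> D' - D. f z = p})"
    and cost: "seg_sum (step_len f) D' 0 M \<le> \<Delta>"
    and near: "seg_sum (\<lambda>u v. if real (v - u) < \<theta>' \<and> (\<exists>p\<in>P. \<bar>p - f u\<bar> < (if real (v - u) < \<theta> then r1 else r2))
      then real (v - u) else 0) D 0 M \<le> B"
  shows "real (card P) \<le> 2 * real M / \<theta>'
    + 2 / r2 * (seg_sum (gap_weight \<theta>' c f) D' 0 M - seg_sum (gap_weight \<theta> c f) D 0 M)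
    + (B + \<theta> * \<Delta> / r1) / m"
proof -
  define near where "near = (\<lambda>u v. real (v - u) < \<theta>' \<and> (\<exists>p\<in>P. \<bar>p - f u\<bar> < (if real (v - u) < \<theta> then r1 else r2)))"
  \<comment> \<open>A gap that is not \<open>bad\<close> is long, or medium and not near.
    \<open>P1\<close> collects the points with a copy in such a gap and is paid for by the gain;
    every new copy of a point of \<open>P2\<close> lies in a \<open>bad\<close> gap.\<close>
  define bad where "bad = (\<lambda>u v. real (v - u) < \<theta> \<or> near u v)"
  define N where "N = (\<lambda>u v. {z \<in> D'. u < z \<and> z < v \<and> f z \<in> P})"
  define W where "W = (\<lambda>u v. seg_sum (step_len f) D' u v)"
  define gain where "gain = (\<lambda>u v. seg_sum (gap_weight \<theta>' c f) D' u v - gap_weight \<theta> c f u v)"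
  define G where "G = seg D 0 M"
  have finG: "finite G" by (simp add: G_def)
  have finN: "finite (N u v)" for u v by (simp add: N_def)
  have finD': "finite D'" using D(4) finite_subset by blast
  have cardN: "real (card (N u v)) \<le> real (v - u)" for u v
  proof -
    have "card (N u v) \<le> card {u<..<v}" by (rule card_mono) (auto simp: N_def)
    then show ?thesis by simp
  qed
  have G: "u \<in> D'" "v \<in> D'" "u < v" if "(u, v) \<in> G" for u v
    using segD[of u v D 0 M] that D(3) by (auto simp: G_def)
  have W0: "0 \<le> W u v" for u v unfolding W_def by (rule seg_sum_nonneg) simp
  have W_ge: "\<bar>f z - f u\<bar> \<le> W u v" if "(u, v) \<in> G" "z \<in> N u v" for u v z
    unfolding W_def using step_len_mid_le_seg_sum[of u D' v z f] G[OF that(1)] that(2)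
    by (auto simp: N_def)
  have gain0: "0 \<le> gain u v" if "(u, v) \<in> G" for u v
    unfolding gain_def using gap_weight_mono[OF G[OF that] pos(2,4), of f] by simp
  have visit: "s * real (card (f ` N u v))
      \<le> s + seg_sum (\<lambda>a b. if real (b - a) < \<theta>' then \<bar>f b - f a\<bar> else s) D' u v"
    if "(u, v) \<in> G" for u v
  proof -
    have "card (f ` N u v) \<le> card (P \<inter> f ` (D' \<inter> {u..v}))"
      by (rule card_mono) (use P in \<open>auto simp: N_def\<close>)
    then have "s * real (card (f ` N u v)) \<le> s * real (card (P \<inter> f ` (D' \<inter> {u..v})))"
      using pos(1) by simp
    also have "\<dots> \<le> s + seg_sum (\<lambda>a b. if real (b - a) < \<theta>' then \<bar>f b - f a\<bar> else s) D' u v"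
      by (rule card_visited_le) (use G[OF that] P pos in auto)
    finally show ?thesis .
  qed
  have inv: "1 / s \<le> 1 / r2" using pos by (simp add: frac_le)
  have good_le: "real (card (f ` N u v)) \<le> 2 * (real (v - u) / \<theta>') + 2 / r2 * gain u v"
    if uv: "(u, v) \<in> G" and nb: "\<not> bad u v" for u v
  proof (cases "real (v - u) < \<theta>'")
    case short: False
    let ?C = "seg_sum (\<lambda>a b. if real (b - a) < \<theta>' then \<bar>f b - f a\<bar> else 0) D' u v"
    \<comment> \<open>For a piece of length at least \<open>\<theta>'\<close>, \<open>s\<close> is
      at most \<open>s / \<theta>'\<close> times its length, so the flat charges spread over the
      length of the gap.\<close>
    have "seg_sum (\<lambda>a b. if real (b - a) < \<theta>' then \<bar>f b - f a\<bar> else s) D' u v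
      \<le> seg_sum (\<lambda>a b. (if real (b - a) < \<theta>' then \<bar>f b - f a\<bar> else 0) + s / \<theta>' * real (b - a)) D' u v"
    proof (rule seg_sum_mono)
      fix a b
      show "(if real (b - a) < \<theta>' then \<bar>f b - f a\<bar> else s)
        \<le> (if real (b - a) < \<theta>' then \<bar>f b - f a\<bar> else 0) + s / \<theta>' * real (b - a)"
      proof (cases "real (b - a) < \<theta>'")
        case False
        then have "1 \<le> real (b - a) / \<theta>'" using pos by simp
        then have "s * 1 \<le> s * (real (b - a) / \<theta>')" by (rule mult_left_mono) (use pos(1) in simp)
        moreover have "s / \<theta>' * real (b - a) = s * (real (b - a) / \<theta>')" by simp
        ultimately show ?thesis using False by (simp only: if_False)
      qed (use pos in auto)
    qed
    also have "\<dots> = ?C + s / \<theta>' * real (v - u)"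
      using seg_sum_length[of u D' v] G[OF uv] by (simp only: seg_sum_plus seg_sum_cmult less_imp_le)
    finally have "s * real (card (f ` N u v)) \<le> s + (?C + s / \<theta>' * real (v - u))"
      using visit[OF uv] by linarith
    moreover have "?C \<le> gain u v"
      using seg_sum_gap_weight_long[OF pos(2), of f D' u v \<theta>'] step_len_le_seg_sum[of u D' v f]
        G[OF uv] short pos by (simp add: gain_def gap_weight_def)
    ultimately have "s * real (card (f ` N u v)) \<le> s * (1 + real (v - u) / \<theta>' + 1 / s * gain u v)"
      using pos(1) by (simp add: algebra_simps)
    then have "real (card (f ` N u v)) \<le> 1 + real (v - u) / \<theta>' + 1 / s * gain u v"
      using pos(1) by (simp only: mult_le_cancel_left_pos)
    \<comment> \<open>The gap itself is long, so the additive 1 for the first visited point is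
      absorbed by the length term; hence the factor 2 there.\<close>
    moreover have "1 \<le> real (v - u) / \<theta>'" using short pos by simp
    moreover have "1 / s * gain u v \<le> 2 / r2 * gain u v"
    proof (rule mult_right_mono)
      have "0 < 1 / r2" using pos by simp
      then show "1 / s \<le> 2 / r2" using inv by linarith
    qed (rule gain0[OF uv])
    ultimately show ?thesis by linarith
  next
    case True
    show ?thesis
    proof (cases "N u v = {}")
      case True
      then show ?thesis using gain0[OF uv] pos by simp
    next
      case False
      then obtain z where z: "z \<in> N u v" by blast
      have long: "\<not> real (v - u) < \<theta>" and nn: "\<not> near u v" using nb by (auto simp: bad_def)
      \<comment> \<open>Being medium and not near, the gap has a left end whose content is at least
        \<open>r2\<close> away from all of \<open>P\<close>; a single visit therefore forces a path
        of that length.\<close>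
      have "r2 \<le> \<bar>f z - f u\<bar>"
        using nn z long True by (auto simp: near_def N_def not_less)
      then have Wr: "r2 \<le> W u v" using W_ge[OF uv z] by linarith
      have "seg_sum (\<lambda>a b. if real (b - a) < \<theta>' then \<bar>f b - f a\<bar> else s) D' u v = W u v"
        unfolding W_def
      proof (rule seg_sum_cong)
        fix a b assume "(a, b) \<in> seg D' u v"
        from segD[OF this] have "b - a \<le> v - u" by linarith
        then show "(if real (b - a) < \<theta>' then \<bar>f b - f a\<bar> else s) = step_len f a b"
          using True by simp
      qed
      then have "s * real (card (f ` N u v)) \<le> s * (1 + 1 / s * W u v)"
        using visit[OF uv] pos(1) by (simp add: algebra_simps)
      then have "real (card (f ` N u v)) \<le> 1 + 1 / s * W u v"
        using pos(1) by (simp only: mult_le_cancel_left_pos)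
      moreover have "1 / s * W u v \<le> 1 / r2 * W u v"
        using inv W0 by (rule mult_right_mono)
      moreover have "1 \<le> 1 / r2 * W u v" using Wr pos by simp
      \<comment> \<open>The old weight is only the direct distance, at most \<open>W u v\<close>,
        whereas at scale \<open>\<theta>'\<close> all pieces are short and their cost counts
        twice.\<close>
      moreover have "W u v \<le> gain u v"
      proof -
        have "0 \<le> c * real (v - u)" using pos by simp
        then show ?thesis
          using seg_sum_gap_weight_short[of u D' v \<theta>' c f] G[OF uv] True long
            step_len_le_seg_sum[of u D' v f]
          by (simp add: gain_def gap_weight_def W_def)
      qed
      then have "2 / r2 * W u v \<le> 2 / r2 * gain u v"
        using pos by (intro mult_left_mono) auto
      moreover have "0 \<le> 2 * (real (v - u) / \<theta>')" using pos by simp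
      ultimately show ?thesis by linarith
    qed
  qed
  \<comment> \<open>A short gap that is not near receives a point of \<open>P\<close> only at cost
    at least \<open>r1\<close>; its fewer than \<open>\<theta>\<close> cells are then charged to
    \<open>\<theta> / r1\<close> times that cost.\<close>
  have bad_le: "real (card (N u v)) \<le> (if near u v then real (v - u) else 0) + \<theta> / r1 * W u v"
    if uv: "(u, v) \<in> G" and b: "bad u v" for u v
  proof (cases "near u v \<or> N u v = {}")
    case True
    have "0 \<le> \<theta> / r1 * W u v" using W0 pos by simp
    then show ?thesis using True cardN[of u v] by auto
  next
    case False
    then obtain z where z: "z \<in> N u v" by blast
    have short: "real (v - u) < \<theta>" using b False by (auto simp: bad_def)
    have "r1 \<le> \<bar>f z - f u\<bar>"
      using False z short pos by (auto simp: near_def N_def not_less)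
    then have "r1 \<le> W u v" using W_ge[OF uv z] by linarith
    then have "1 \<le> W u v / r1" using pos by simp
    then have "\<theta> * 1 \<le> \<theta> * (W u v / r1)" using pos by (intro mult_left_mono) auto
    then show ?thesis using cardN[of u v] short False by simp
  qed
  have fin1: "finite {(u, v) \<in> G. \<not> bad u v}" and fin2: "finite {(u, v) \<in> G. bad u v}"
    by (auto intro: finite_subset[OF _ finG])
  define P1 where "P1 = P \<inter> (\<Union>(u, v)\<in>{(u, v)\<in>G. \<not> bad u v}. f ` N u v)"
  define P2 where "P2 = P - P1"
  have "card P1 \<le> card (\<Union>(u, v)\<in>{(u, v)\<in>G. \<not> bad u v}. f ` N u v)"
    unfolding P1_def by (rule card_mono) (use fin1 finN in \<open>auto split: prod.splits\<close>)
  also have "\<dots> \<le> (\<Sum>x\<in>{(u, v)\<in>G. \<not> bad u v}. card (case x of (u, v) \<Rightarrow> f ` N u v))"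
    by (rule card_UN_le) (rule fin1)
  finally have "real (card P1) \<le> (\<Sum>(u, v)\<in>{(u, v)\<in>G. \<not> bad u v}. real (card (f ` N u v)))"
    by (simp add: case_prod_unfold flip: of_nat_sum)
  also have "\<dots> \<le> (\<Sum>(u, v)\<in>{(u, v)\<in>G. \<not> bad u v}. 2 * (real (v - u) / \<theta>') + 2 / r2 * gain u v)"
    by (rule sum_mono) (use good_le in auto)
  also have "\<dots> \<le> (\<Sum>(u, v)\<in>G. 2 * (real (v - u) / \<theta>') + 2 / r2 * gain u v)"
    by (rule sum_mono2) (use finG pos gain0 in auto)
  also have "\<dots> = seg_sum (\<lambda>u v. 2 / \<theta>' * real (v - u) + 2 / r2 * gain u v) D 0 M"
    by (simp add: seg_sum_def G_def)
  also have "\<dots> = 2 * real M / \<theta>' + 2 / r2 * seg_sum gain D 0 M"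
    using seg_sum_length[OF D(1,2)] by (simp only: seg_sum_plus seg_sum_cmult) simp
  also have "seg_sum gain D 0 M = seg_sum (seg_sum (gap_weight \<theta>' c f) D') D 0 M - seg_sum (gap_weight \<theta> c f) D 0 M"
    unfolding gain_def seg_sum_def by (simp add: case_prod_unfold sum_subtractf)
  also have "seg_sum (seg_sum (gap_weight \<theta>' c f) D') D 0 M = seg_sum (gap_weight \<theta>' c f) D' 0 M"
    using seg_sum_refine[OF D(3,1,2)] by simp
  finally have le1: "real (card P1) \<le> 2 * real M / \<theta>'
    + 2 / r2 * (seg_sum (gap_weight \<theta>' c f) D' 0 M - seg_sum (gap_weight \<theta> c f) D 0 M)" .

  have finP2: "finite P2" using P by (simp add: P2_def)
  \<comment> \<open>Double counting: each point of \<open>P2\<close> has at least \<open>m\<close>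
    new copies, in distinct cells, all inside \<open>bad\<close> gaps.\<close>
  have "m * real (card P2) \<le> (\<Sum>p\<in>P2. real (card {z \<in> D' - D. f z = p}))"
    using sum_bounded_below[of P2 m "\<lambda>p. real (card {z \<in> D' - D. f z = p})"] copies
    by (simp add: P2_def mult.commute)
  also have "\<dots> = real (card (\<Union>p\<in>P2. {z \<in> D' - D. f z = p}))"
    by (subst card_UN_disjoint) (use finP2 finD' in auto)
  also have "\<dots> \<le> real (card (\<Union>(u, v)\<in>{(u, v)\<in>G. bad u v}. N u v))"
  proof -
    have "(\<Union>p\<in>P2. {z \<in> D' - D. f z = p}) \<subseteq> (\<Union>(u, v)\<in>{(u, v)\<in>G. bad u v}. N u v)"
    proof
      fix z assume "z \<in> (\<Union>p\<in>P2. {z \<in> D' - D. f z = p})"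
      then have z: "z \<in> D'" "z \<notin> D" "f z \<in> P2" by auto
      moreover have "z \<le> M" using z D(4) by auto
      ultimately obtain u v where uv: "(u, v) \<in> seg D 0 M" "u < z" "z < v"
        using seg_exists[of 0 D M z] D z by auto
      have "z \<in> N u v" using z uv by (auto simp: N_def P2_def)
      moreover have "bad u v"
      proof (rule ccontr)
        assume "\<not> bad u v"
        then have "f z \<in> P1" using uv z \<open>z \<in> N u v\<close> by (auto simp: P1_def P2_def G_def)
        then show False using z by (simp add: P2_def)
      qed
      ultimately show "z \<in> (\<Union>(u, v)\<in>{(u, v)\<in>G. bad u v}. N u v)" using uv by (auto simp: G_def)
    qed
    then show ?thesis by (intro of_nat_mono card_mono) (use fin2 finN in \<open>auto split: prod.splits\<close>)
  qed
  also have "\<dots> \<le> real (\<Sum>x\<in>{(u, v)\<in>G. bad u v}. card (case x of (u, v) \<Rightarrow> N u v))"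
    by (intro of_nat_mono card_UN_le fin2)
  also have "\<dots> = (\<Sum>(u, v)\<in>{(u, v)\<in>G. bad u v}. real (card (N u v)))"
    by (simp add: case_prod_unfold)
  also have "\<dots> \<le> (\<Sum>(u, v)\<in>{(u, v)\<in>G. bad u v}. (if near u v then real (v - u) else 0) + \<theta> / r1 * W u v)"
    by (rule sum_mono) (use bad_le in auto)
  also have "\<dots> \<le> (\<Sum>(u, v)\<in>G. (if near u v then real (v - u) else 0) + \<theta> / r1 * W u v)"
    by (rule sum_mono2) (use finG pos W0 in auto)
  also have "\<dots> = seg_sum (\<lambda>u v. if near u v then real (v - u) else 0) D 0 M + \<theta> / r1 * seg_sum W D 0 M"
    by (simp add: seg_sum_def G_def case_prod_unfold sum.distrib sum_distrib_left)
  also have "seg_sum W D 0 M = seg_sum (step_len f) D' 0 M"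
    unfolding W_def using seg_sum_refine[OF D(3,1,2)] by simp
  finally have "m * real (card P2) \<le> B + \<theta> / r1 * seg_sum (step_len f) D' 0 M"
    using near unfolding near_def by linarith
  moreover have "\<theta> / r1 * seg_sum (step_len f) D' 0 M \<le> \<theta> / r1 * \<Delta>"
    using cost pos by (intro mult_left_mono) auto
  ultimately have "m * real (card P2) \<le> B + \<theta> * \<Delta> / r1" by simp
  then have le2: "real (card P2) \<le> (B + \<theta> * \<Delta> / r1) / m"
    using pos by (simp add: pos_le_divide_eq mult.commute)
  have "P1 \<subseteq> P" by (auto simp: P1_def)
  then have "card P = card P1 + card P2"
    using P(1) finite_subset[of P1 P] by (simp add: P2_def card_Diff_subset card_mono)
  then show ?thesis using le1 le2 by simp
qed

lemma card_nats_in_interval: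
  fixes a l :: real
  assumes "0 \<le> l"
  shows "real (card {i::nat. a < real i \<and> real i < a + l}) \<le> l + 1"
proof -
  let ?S = "{i::nat. a < real i \<and> real i < a + l}"
  have "int ` ?S \<subseteq> {\<lfloor>a\<rfloor> + 1..\<lceil>a + l\<rceil> - 1}"
    by (auto simp: less_ceiling_iff) (linarith+)?
  then have "card (int ` ?S) \<le> card {\<lfloor>a\<rfloor> + 1..\<lceil>a + l\<rceil> - 1}" by (intro card_mono) auto
  then have "card ?S \<le> nat (\<lceil>a + l\<rceil> - \<lfloor>a\<rfloor> - 1)" by (simp add: card_image)
  then show ?thesis using assms by linarith
qed


subsection \<open>Choosing the shift\<close>

text \<open>The shift is a fraction \<open>q / Q\<close> of the spacing \<open>1 / J\<close>. Over
  all \<open>q < Q\<close> the points run once through the multiples of \<open>1 / (J * Q)\<close>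
  below 1, so averaging over shifts is a count of integers.\<close>

definition lattice :: "nat \<Rightarrow> nat \<Rightarrow> nat \<Rightarrow> real set" where
  "lattice Q J q = (\<lambda>j. (real j + real q / real Q) / real J) ` {..<J}"

lemma lattice_finite [simp]: "finite (lattice Q J q)"
  by (simp add: lattice_def)

lemma lattice_inj: "0 < J \<Longrightarrow> inj_on (\<lambda>j. (real j + real q / real Q) / real J) {..<J}"
  by (auto intro!: inj_onI)

lemma lattice_card: "card (lattice Q J q) = J"
proof (cases "J = 0")
  case False
  then show ?thesis unfolding lattice_def by (subst card_image) (auto intro!: lattice_inj)
qed (simp add: lattice_def)

lemma lattice_bounds:
  assumes "q < Q" "p \<in> lattice Q J q"
  shows "0 \<le> p" "p \<le> 1"
proof -
  obtain j where j: "j < J" "p = (real j + real q / real Q) / real J"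
    using assms(2) by (auto simp: lattice_def)
  show "0 \<le> p" using j by simp
  have "real q / real Q \<le> 1" using assms(1) by simp
  moreover have "real j + 1 \<le> real J" using j(1) by linarith
  ultimately have "real j + real q / real Q \<le> real J" by linarith
  then show "p \<le> 1" using j by simp
qed

lemma lattice_sep:
  assumes "0 < J" "p \<in> lattice Q J q" "p' \<in> lattice Q J q" "p \<noteq> p'"
  shows "1 / real J \<le> \<bar>p - p'\<bar>"
proof -
  obtain i j where ij: "p = (real i + real q / real Q) / real J" "p' = (real j + real q / real Q) / real J"
    using assms by (auto simp: lattice_def)
  then have "i \<noteq> j" using assms by auto
  then have "1 \<le> \<bar>real i - real j\<bar>" by linarith
  moreover have "p - p' = (real i - real j) / real J"
    by (simp add: ij diff_divide_distrib[symmetric])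
  ultimately show ?thesis using assms(1) by (simp add: divide_right_mono)
qed

text \<open>An interval of radius \<open>r\<close> contains at most \<open>2 * r * J * Q + 1\<close>
  points of the common grid, and the index of a grid point modulo \<open>Q\<close> determines its
  shift.\<close>

lemma card_near_shifts:
  assumes "0 < J" "0 < Q" "0 \<le> r"
  shows "real (card {q. q < Q \<and> (\<exists>p\<in>lattice Q J q. \<bar>p - a\<bar> < r)}) \<le> 2 * r * real J * real Q + 1"
proof -
  define w where "w = real J * real Q"
  have w: "0 < w" using assms by (simp add: w_def)
  let ?I = "{i::nat. a * w - r * w < real i \<and> real i < (a * w - r * w) + 2 * r * w}"
  have fin: "finite ?I"
    by (rule finite_subset[of _ "{..nat \<lceil>a * w + r * w\<rceil>}"]) (auto, linarith)
  have "{q. q < Q \<and> (\<exists>p\<in>lattice Q J q. \<bar>p - a\<bar> < r)} \<subseteq> (\<lambda>i. i mod Q) ` ?I"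
  proof
    fix q assume "q \<in> {q. q < Q \<and> (\<exists>p\<in>lattice Q J q. \<bar>p - a\<bar> < r)}"
    then obtain j where q: "q < Q" and j: "\<bar>(real j + real q / real Q) / real J - a\<bar> < r"
      by (auto simp: lattice_def)
    have e: "(real j + real q / real Q) / real J = real (j * Q + q) / w"
      using assms by (simp add: w_def field_simps)
    have "\<bar>real (j * Q + q) / w - a\<bar> * w < r * w"
      using j w unfolding e by simp
    moreover have "\<bar>real (j * Q + q) / w - a\<bar> * w = \<bar>real (j * Q + q) - a * w\<bar>"
      using w by (simp add: abs_mult_pos' field_simps abs_mult[symmetric])
    ultimately have "\<bar>real (j * Q + q) - a * w\<bar> < r * w" by simp
    then have "j * Q + q \<in> ?I" unfolding mem_Collect_eq by linarith
    then show "q \<in> (\<lambda>i. i mod Q) ` ?I" using q by (intro image_eqI[of _ _ "j * Q + q"]) auto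
  qed
  then have "card {q. q < Q \<and> (\<exists>p\<in>lattice Q J q. \<bar>p - a\<bar> < r)} \<le> card ?I"
    using fin by (meson card_image_le card_mono finite_imageI le_trans)
  also have "real (card ?I) \<le> 2 * r * w + 1"
    by (rule card_nats_in_interval) (use assms w in auto)
  finally show ?thesis by (simp add: w_def mult.assoc)
qed

text \<open>Averaging over the \<open>Q\<close> shifts: a gap is near for at most a fraction
  \<open>3 * r * J\<close> of them, with \<open>r\<close> the radius for its length. Short gaps have
  total length at most \<open>M\<close>, medium ones at most \<open>\<mu>\<close>.\<close>

lemma exists_good_shift:
  fixes r1 r2 \<mu> \<theta> \<theta>' :: real
  assumes "0 < J" "0 < Q" "1 \<le> r1 * real J * real Q" "1 \<le> r2 * real J * real Q"
    and "0 \<in> D" "M \<in> D"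
    and "seg_sum (\<lambda>u v. if \<theta> \<le> real (v - u) \<and> real (v - u) < \<theta>' then real (v - u) else 0) D 0 M \<le> \<mu>"
  shows "\<exists>q<Q. seg_sum (\<lambda>u v. if real (v - u) < \<theta>' \<and>
        (\<exists>p\<in>lattice Q J q. \<bar>p - f u\<bar> < (if real (v - u) < \<theta> then r1 else r2)) then real (v - u) else 0) D 0 M
      \<le> 3 * r1 * real J * real M + 3 * r2 * real J * \<mu>"
proof -
  have r: "0 < r1" "0 < r2"
    using assms(1-4) by (auto simp: zero_less_mult_iff dest: less_le_trans[OF zero_less_one])
  define r where "r = (\<lambda>u v. if real (v - u) < \<theta> then r1 else r2)"
  define near where "near = (\<lambda>q u v. real (v - u) < \<theta>' \<and> (\<exists>p\<in>lattice Q J q. \<bar>p - f u\<bar> < r u v))"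
  define S where "S = (\<lambda>q. seg_sum (\<lambda>u v. if near q u v then real (v - u) else 0) D 0 M)"
  define B where "B = 3 * r1 * real J * real M + 3 * r2 * real J * \<mu>"
  have cnt: "(\<Sum>q<Q. if near q u v then real (v - u) else 0)
    \<le> real Q * (3 * r1 * real J * real (v - u) + 3 * r2 * real J *
         (if \<theta> \<le> real (v - u) \<and> real (v - u) < \<theta>' then real (v - u) else 0))" (is "?L \<le> ?R")
    for u v
  proof (cases "real (v - u) < \<theta>'")
    case False
    then have "?L = 0" by (simp add: near_def)
    then show ?thesis using r by simp
  next
    case True
    have "?L = (\<Sum>q\<in>{q. q < Q \<and> near q u v}. real (v - u))"
      by (rule sum.mono_neutral_cong_right) auto
    also have "{q. q < Q \<and> near q u v} = {q. q < Q \<and> (\<exists>p\<in>lattice Q J q. \<bar>p - f u\<bar> < r u v)}"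
      using True by (auto simp: near_def)
    also have "(\<Sum>q\<in>\<dots>. real (v - u)) = real (card \<dots>) * real (v - u)" by simp
    also have "\<dots> \<le> (2 * r u v * real J * real Q + 1) * real (v - u)"
      by (intro mult_right_mono card_near_shifts) (use assms r in \<open>auto simp: r_def\<close>)
    \<comment> \<open>The lower bounds on the two radii turn the rounding term 1 into a third copy
      of the main term.\<close>
    also have "\<dots> \<le> (3 * r u v * real J * real Q) * real (v - u)"
      by (rule mult_right_mono) (use assms(3,4) in \<open>auto simp: r_def mult_ac\<close>)
    also have "\<dots> \<le> ?R"
      using True r by (auto simp: r_def algebra_simps)
    finally show ?thesis .
  qed
  have "(\<Sum>q<Q. S q) = seg_sum (\<lambda>u v. \<Sum>q<Q. if near q u v then real (v - u) else 0) D 0 M"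
    unfolding S_def seg_sum_def by (subst sum.swap) (simp add: case_prod_unfold)
  also have "\<dots> \<le> seg_sum (\<lambda>u v. real Q * (3 * r1 * real J * real (v - u) + 3 * r2 * real J *
         (if \<theta> \<le> real (v - u) \<and> real (v - u) < \<theta>' then real (v - u) else 0))) D 0 M"
    by (rule seg_sum_mono) (rule cnt)
  also have "\<dots> = real Q * (3 * r1 * real J * real (M - 0) + 3 * r2 * real J *
     seg_sum (\<lambda>u v. if \<theta> \<le> real (v - u) \<and> real (v - u) < \<theta>' then real (v - u) else 0) D 0 M)"
    using seg_sum_length[of 0 D M] assms by (simp only: seg_sum_plus seg_sum_cmult)
  also have "\<dots> \<le> real Q * B"
    unfolding B_def using assms r by (intro mult_left_mono add_mono) auto
  finally have sum: "(\<Sum>q<Q. S q) \<le> real Q * B" .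
  have "\<exists>q<Q. S q \<le> B"
  proof (rule ccontr)
    assume "\<not> ?thesis"
    then have "(\<Sum>q<Q. B) < (\<Sum>q<Q. S q)" using assms by (intro sum_strict_mono) auto
    then show False using sum by simp
  qed
  then show ?thesis unfolding S_def B_def near_def r_def .
qed


subsection \<open>One phase\<close>

text \<open>The shift is fixed before \<open>D'\<close> and \<open>f'\<close>, since the adversary
  commits to the reals of a phase before seeing their cells. Either medium gaps are plentiful and
  gain by becoming short, or a good shift exists and \<open>card_points_le\<close> forces the
  gain.\<close>

lemma phase_gain:
  fixes \<gamma> \<Delta> :: real
  assumes pos: "0 < T" "0 < n" "0 < J" and g: "1 \<le> \<gamma>" "\<gamma> \<le> real T" "\<Delta> \<le> real T"
    and M: "real M \<le> 2 * \<gamma> * real n" and m: "real n / (2 * real T * real J) \<le> real m"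
    and D: "0 \<in> D" "M \<in> D"
    and \<theta>: "\<theta> = real n / (1536 * real T ^ 4 * real J)" and \<theta>': "\<theta>' = 16 * real T * real n / real J"
    and c: "c = 9 * real T / (36864 * \<gamma>\<^sup>2 * real n)"
  shows "\<exists>q < 192 * T\<^sup>2. \<forall>D' f'. D \<subseteq> D' \<longrightarrow> D' \<subseteq> {0..M} \<longrightarrow> (\<forall>z\<in>D. f' z = f z) \<longrightarrow>
      (\<forall>p\<in>lattice (192 * T\<^sup>2) J q. m \<le> card {z \<in> D' - D. f' z = p}) \<longrightarrow>
      seg_sum (step_len f') D' 0 M \<le> \<Delta> \<longrightarrow>
      seg_sum (gap_weight \<theta> c f) D 0 M + 1 / (1024 * \<gamma>) \<le> seg_sum (gap_weight \<theta>' c f') D' 0 M"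
proof -
  let ?Q = "192 * T\<^sup>2"
  \<comment> \<open>The radii and \<open>\<mu>\<close> make the two parts of the bound on near gaps
    at most \<open>n / (16 * T)\<close> each, and \<open>c * \<mu>\<close> equal to
    \<open>1 / (1024 * \<gamma>)\<close>.\<close>
  define r1 where "r1 = 1 / (96 * (real T)\<^sup>2 * real J)"
  define r2 where "r2 = 1 / (192 * \<gamma> * real J)"
  define \<mu> where "\<mu> = 4 * \<gamma> * real n / real T"
  have T1: "1 \<le> real T" "1 \<le> real J" using pos by auto
  have c0: "0 \<le> c" using g pos by (simp add: c)
  have th0: "0 < \<theta>" "0 < \<theta>'" using pos by (simp_all add: \<theta> \<theta>')
  have th_le: "\<theta> \<le> \<theta>'"
  proof -
    have "real n / (1536 * real T ^ 4 * real J) \<le> real n / (1 * real J)"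
    proof (rule divide_left_mono)
      have "1 * 1 \<le> 1536 * real T ^ 4" using T1 by (intro mult_mono) auto
      then show "1 * real J \<le> 1536 * real T ^ 4 * real J" by (intro mult_right_mono) auto
    qed (use pos in auto)
    also have "\<dots> \<le> 16 * real T * real n / real J"
    proof -
      have "1 * real n \<le> 16 * real T * real n" using T1 by (intro mult_right_mono) auto
      then show ?thesis by (simp add: divide_right_mono)
    qed
    finally show ?thesis by (simp add: \<theta> \<theta>')
  qed
  define med where "med = (\<lambda>u v. if \<theta> \<le> real (v - u) \<and> real (v - u) < \<theta>' then real (v - u) else 0)"
  show ?thesis
  proof (cases "seg_sum med D 0 M \<le> \<mu>")
    \<comment> \<open>Any shift works here: medium gaps and all their pieces are short at scale
      \<open>\<theta>'\<close>, which adds \<open>c\<close> times their total length to the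
      potential.\<close>
    case False
    have "seg_sum (gap_weight \<theta> c f) D 0 M + 1 / (1024 * \<gamma>) \<le> seg_sum (gap_weight \<theta>' c f') D' 0 M"
      if D': "D \<subseteq> D'" "\<forall>z\<in>D. f' z = f z" for D' f'
    proof -
      have "1 / (1024 * \<gamma>) = c * \<mu>"
        using g pos by (simp add: c \<mu>_def field_simps power2_eq_square)
      also have "\<dots> \<le> c * seg_sum med D 0 M" using False c0 by (intro mult_left_mono) auto
      finally have "seg_sum (gap_weight \<theta> c f) D 0 M + 1 / (1024 * \<gamma>)
        \<le> seg_sum (\<lambda>u v. gap_weight \<theta> c f u v + c * med u v) D 0 M"
        by (simp add: seg_sum_plus seg_sum_cmult)
      also have "\<dots> \<le> seg_sum (seg_sum (gap_weight \<theta>' c f') D') D 0 M"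
      proof (rule seg_sum_mono)
        fix u v assume uv: "(u, v) \<in> seg D 0 M"
        have "f' u = f u" "f' v = f v" using segD(1,2)[OF uv] D'(2) by auto
        then have "gap_weight \<theta> c f u v + c * med u v \<le> gap_weight \<theta>' c f' u v"
          using th_le by (auto simp: gap_weight_def med_def)
        also have "\<dots> \<le> seg_sum (gap_weight \<theta>' c f') D' u v"
          by (rule gap_weight_mono) (use segD[OF uv] D'(1) c0 in auto)
        finally show "gap_weight \<theta> c f u v + c * med u v \<le> seg_sum (gap_weight \<theta>' c f') D' u v" .
      qed
      also have "\<dots> = seg_sum (gap_weight \<theta>' c f') D' 0 M"
        using seg_sum_refine[OF D'(1) D] by simp
      finally show ?thesis .
    qed
    then show ?thesis using pos by (intro exI[of _ 0]) auto
  next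
    case True
    have r1Q: "1 \<le> r1 * real J * real ?Q"
      using pos by (simp add: r1_def power2_eq_square)
    have r2Q: "1 \<le> r2 * real J * real ?Q"
    proof -
      have "real T * 1 \<le> real T * real T" using T1 by (intro mult_left_mono) auto
      then have "\<gamma> \<le> real T * real T" using g by linarith
      then show ?thesis using pos g by (simp add: r2_def power2_eq_square)
    qed
    obtain q where q: "q < ?Q" and B: "seg_sum (\<lambda>u v. if real (v - u) < \<theta>' \<and>
        (\<exists>p\<in>lattice ?Q J q. \<bar>p - f u\<bar> < (if real (v - u) < \<theta> then r1 else r2)) then real (v - u) else 0) D 0 M
      \<le> 3 * r1 * real J * real M + 3 * r2 * real J * \<mu>"
      using exists_good_shift[OF pos(3) _ r1Q r2Q D True[unfolded med_def]] pos by fastforce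
    have "3 * r1 * real J * real M = real M / (32 * (real T)\<^sup>2)"
      using pos by (simp add: r1_def)
    also have "\<dots> \<le> 2 * real T * real n / (32 * (real T)\<^sup>2)"
    proof (rule divide_right_mono)
      have "2 * \<gamma> * real n \<le> 2 * real T * real n" using g by (intro mult_right_mono) auto
      then show "real M \<le> 2 * real T * real n" using M by linarith
    qed auto
    also have "\<dots> = real n / (16 * real T)" using pos by (simp add: power2_eq_square)
    finally have B1: "3 * r1 * real J * real M \<le> real n / (16 * real T)" .
    have B2: "3 * r2 * real J * \<mu> = real n / (16 * real T)"
      using pos g by (simp add: r2_def \<mu>_def field_simps)
    have "seg_sum (gap_weight \<theta> c f) D 0 M + 1 / (1024 * \<gamma>) \<le> seg_sum (gap_weight \<theta>' c f') D' 0 M"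
      if D': "D \<subseteq> D'" "D' \<subseteq> {0..M}" "\<forall>z\<in>D. f' z = f z"
        and copies: "\<forall>p\<in>lattice ?Q J q. m \<le> card {z \<in> D' - D. f' z = p}"
        and cost: "seg_sum (step_len f') D' 0 M \<le> \<Delta>" for D' f'
    proof -
      define I where "I = seg_sum (gap_weight \<theta>' c f') D' 0 M - seg_sum (gap_weight \<theta> c f') D 0 M"
      have Z: "seg_sum (gap_weight \<theta> c f') D 0 M = seg_sum (gap_weight \<theta> c f) D 0 M"
      proof (rule seg_sum_cong)
        fix u v assume "(u, v) \<in> seg D 0 M"
        then have "f' u = f u" "f' v = f v" using D'(3) segD(1,2) by blast+
        then show "gap_weight \<theta> c f' u v = gap_weight \<theta> c f u v" by (simp add: gap_weight_def)
      qed
      have near: "seg_sum (\<lambda>u v. if real (v - u) < \<theta>' \<and>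
        (\<exists>p\<in>lattice ?Q J q. \<bar>p - f' u\<bar> < (if real (v - u) < \<theta> then r1 else r2)) then real (v - u) else 0) D 0 M
        \<le> real n / (8 * real T)" (is "?S \<le> _")
      proof -
        have "?S = seg_sum (\<lambda>u v. if real (v - u) < \<theta>' \<and>
        (\<exists>p\<in>lattice ?Q J q. \<bar>p - f u\<bar> < (if real (v - u) < \<theta> then r1 else r2)) then real (v - u) else 0) D 0 M"
        proof (rule seg_sum_cong)
          fix u v assume "(u, v) \<in> seg D 0 M"
          then have "f' u = f u" using D'(3) segD(1) by blast
          then show "(if real (v - u) < \<theta>' \<and>
              (\<exists>p\<in>lattice ?Q J q. \<bar>p - f' u\<bar> < (if real (v - u) < \<theta> then r1 else r2)) then real (v - u) else 0)
            = (if real (v - u) < \<theta>' \<and>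
              (\<exists>p\<in>lattice ?Q J q. \<bar>p - f u\<bar> < (if real (v - u) < \<theta> then r1 else r2)) then real (v - u) else 0)"
            by simp
        qed
        then show ?thesis using B B1 B2 by (simp add: field_simps)
      qed
      have m0: "0 < real n / (2 * real T * real J)" using pos by simp
      have "real (card (lattice ?Q J q)) \<le> 2 * real M / \<theta>' + 2 / r2 * I
        + (real n / (8 * real T) + \<theta> * \<Delta> / r1) / (real n / (2 * real T * real J))"
        unfolding I_def
      proof (rule card_points_le[OF D D'(1,2), where s = "1 / real J"])
        show "r2 \<le> 1 / real J" using g pos by (simp add: r2_def field_simps)
        show "real n / (2 * real T * real J) \<le> real (card {z \<in> D' - D. f' z = p})"
          if "p \<in> lattice ?Q J q" for p
          using copies that m by (meson of_nat_le_iff order_trans)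
      qed (use lattice_sep pos c0 th0 th_le m0 cost near g in \<open>auto simp: r1_def r2_def\<close>)
      also have "2 * real M / \<theta>' \<le> real J / 4"
      proof -
        have "2 * \<gamma> * real n \<le> 2 * real T * real n" using g by (intro mult_right_mono) auto
        then have "2 * real M / \<theta>' \<le> (4 * real T * real n) / \<theta>'"
          using M th0 by (intro divide_right_mono) auto
        also have "\<dots> = real J / 4" using pos by (simp add: \<theta>' field_simps)
        finally show ?thesis .
      qed
      also have "2 / r2 * I = 384 * \<gamma> * real J * I" by (simp add: r2_def)
      also have "(real n / (8 * real T) + \<theta> * \<Delta> / r1) / (real n / (2 * real T * real J)) \<le> 3 / 8 * real J"
      proof -
        have "\<theta> * \<Delta> / r1 \<le> \<theta> * real T / r1"
          using g th0 pos by (intro divide_right_mono mult_left_mono) (auto simp: r1_def)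
        also have "\<dots> = real n / (16 * real T)"
          using pos by (simp add: \<theta> r1_def field_simps power2_eq_square power4_eq_xxxx)
        finally have "real n / (8 * real T) + \<theta> * \<Delta> / r1 \<le> 3 * real n / (16 * real T)" by (simp add: field_simps)
        then have "(real n / (8 * real T) + \<theta> * \<Delta> / r1) / (real n / (2 * real T * real J))
          \<le> 3 * real n / (16 * real T) / (real n / (2 * real T * real J))"
          using m0 by (intro divide_right_mono) auto
        also have "\<dots> = 3 / 8 * real J" using pos by (simp add: field_simps)
        finally show ?thesis .
      qed
      \<comment> \<open>The length term takes a quarter and the \<open>bad\<close> gaps three
        eighths of the \<open>J\<close> points; the remaining three eighths must come from the gain
        \<open>I\<close>.\<close>
      finally have "real J \<le> real J / 4 + 384 * \<gamma> * real J * I + 3 / 8 * real J"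
        by (simp add: lattice_card)
      then have "real J * 1 \<le> real J * (1024 * \<gamma> * I)" by (simp add: algebra_simps)
      then have "1 \<le> 1024 * \<gamma> * I" using pos by (simp only: mult_le_cancel_left_pos of_nat_0_less_iff)
      then have "1 / (1024 * \<gamma>) \<le> I" using g by (simp add: field_simps)
      then show ?thesis unfolding I_def Z by simp
    qed
    then show ?thesis using q by blast
  qed
qed

subsection \<open>Runs of an online algorithm\<close>

text \<open>Cells are shifted by one, so that 0 and \<open>Suc N\<close> can hold the sentinels
  \<open>r_0 = 0\<close> and \<open>r_{n+1} = 1\<close>.\<close>
definition occupied :: "online_alg \<Rightarrow> nat \<Rightarrow> real list \<Rightarrow> nat set" where
  "occupied A N xs = insert 0 (insert (Suc N) ((\<lambda>i. Suc (place A xs i)) ` {..<length xs}))"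

text \<open>The value at an empty cell is immaterial, as gap sums evaluate it at occupied cells
  only.\<close>

definition contents :: "online_alg \<Rightarrow> nat \<Rightarrow> real list \<Rightarrow> nat \<Rightarrow> real" where
  "contents A N xs z = (if z = 0 then 0 else if z = Suc N then 1
     else xs ! inv_into {..<length xs} (\<lambda>i. Suc (place A xs i)) z)"

lemma contents_ends [simp]: "contents A N xs 0 = 0" "contents A N xs (Suc N) = 1"
  by (simp_all add: contents_def)

lemma contents_place:
  assumes "valid_run A N xs" "i < length xs"
  shows "contents A N xs (Suc (place A xs i)) = xs ! i"
proof -
  have inj: "inj_on (\<lambda>i. Suc (place A xs i)) {..<length xs}"
    using assms(1) by (auto simp: valid_run_def inj_on_def)
  have "place A xs i < N" using assms by (auto simp: valid_run_def)
  moreover have "inv_into {..<length xs} (\<lambda>i. Suc (place A xs i)) (Suc (place A xs i)) = i"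
    by (rule inv_into_f_f[OF inj]) (use assms in simp)
  ultimately show ?thesis by (simp add: contents_def)
qed

lemma place_append: "i < length xs \<Longrightarrow> place A (xs @ ys) i = place A xs i"
  by (simp add: place_def)

lemma valid_run_appendD: "valid_run A N (xs @ ys) \<Longrightarrow> valid_run A N xs"
proof -
  assume v: "valid_run A N (xs @ ys)"
  have *: "place A xs i = place A (xs @ ys) i" if "i < length xs" for i
    using that by (simp add: place_append)
  show "valid_run A N xs"
    using v unfolding valid_run_def inj_on_def by (simp add: *)
qed

lemma occupied_subset: "valid_run A N xs \<Longrightarrow> occupied A N xs \<subseteq> {0..Suc N}"
  by (auto simp: occupied_def valid_run_def less_imp_le)

lemma occupied_append: "occupied A N xs \<subseteq> occupied A N (xs @ ys)"
proof -
  have "(\<lambda>i. Suc (place A xs i)) ` {..<length xs} \<subseteq> (\<lambda>i. Suc (place A (xs @ ys) i)) ` {..<length (xs @ ys)}"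
    by (rule image_subsetI) (auto simp flip: place_append[of _ xs A ys])
  then show ?thesis unfolding occupied_def by blast
qed

lemma contents_append:
  assumes "valid_run A N (xs @ ys)" "z \<in> occupied A N xs"
  shows "contents A N (xs @ ys) z = contents A N xs z"
proof -
  consider "z = 0" | "z = Suc N" | i where "i < length xs" "z = Suc (place A xs i)"
    using assms(2) by (auto simp: occupied_def)
  then show ?thesis
  proof cases
    case 3
    then show ?thesis
      using contents_place[OF assms(1), of i] contents_place[OF valid_run_appendD[OF assms(1)], of i]
      by (simp add: place_append nth_append)
  qed simp_all
qed

text \<open>Injectivity of the placement sends the copies of \<open>p\<close> in \<open>ys\<close>
  to distinct cells, none of them filled during \<open>xs\<close>.\<close>

lemma count_copies:
  assumes v: "valid_run A N (xs @ ys)"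
  shows "length (filter ((=) p) ys)
    \<le> card {z \<in> occupied A N (xs @ ys) - occupied A N xs. contents A N (xs @ ys) z = p}"
proof -
  let ?g = "\<lambda>i. Suc (place A (xs @ ys) (length xs + i))"
  let ?I = "{i. i < length ys \<and> p = ys ! i}"
  have inj: "inj_on (place A (xs @ ys)) {..<length (xs @ ys)}" and lt: "\<And>i. i < length (xs @ ys) \<Longrightarrow> place A (xs @ ys) i < N"
    using v by (auto simp: valid_run_def)
  have "?g i \<notin> occupied A N xs" if "i < length ys" for i
  proof
    assume "?g i \<in> occupied A N xs"
    moreover have "place A (xs @ ys) (length xs + i) < N" using lt that by simp
    ultimately obtain j where "j < length xs" "place A (xs @ ys) (length xs + i) = place A (xs @ ys) j"
      by (auto simp: occupied_def place_append)
    then have "length xs + i = j" using inj_onD[OF inj] that by simp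
    then show False using \<open>j < length xs\<close> by simp
  qed
  then have "?g ` ?I \<subseteq> {z \<in> occupied A N (xs @ ys) - occupied A N xs. contents A N (xs @ ys) z = p}"
    using contents_place[OF v] by (auto simp: occupied_def)
  moreover have "finite {z \<in> occupied A N (xs @ ys) - occupied A N xs. contents A N (xs @ ys) z = p}"
    by (simp add: occupied_def)
  moreover have "card (?g ` ?I) = card ?I"
    by (rule card_image) (auto intro!: inj_onI dest: inj_onD[OF inj])
  ultimately show ?thesis
    unfolding length_filter_conv_card by (metis (no_types, lifting) card_mono)
qed

section \<open>The cost of a run as a sum over gaps\<close>

text \<open>Neighbours in a strictly increasing list are exactly the gaps of its set.\<close>

lemma path_cost_eq_seg_sum:
  assumes "sorted_wrt (<) ps" "ps \<noteq> []"
  shows "path_cost (map f ps) = seg_sum (step_len f) (set ps) (hd ps) (last ps)"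
  using assms
proof (induction ps rule: induct_list012)
  case (3 x y ps)
  have "seg_sum (step_len f) (set (x # y # ps)) x (last (y # ps))
    = \<bar>f y - f x\<bar> + seg_sum (step_len f) (set (x # y # ps)) y (last (y # ps))"
    by (rule seg_sum_step) (use 3(3) in \<open>auto simp: less_imp_le\<close>)
  also have "seg_sum (step_len f) (set (x # y # ps)) y (last (y # ps))
    = seg_sum (step_len f) (set (y # ps)) y (last (y # ps))"
    unfolding seg_sum_def by (subst seg_cong[of _ _ _ "set (y # ps)"]) (use 3(3) in auto)
  finally show ?case using 3 by (simp add: path_cost_def)
qed (simp_all add: path_cost_def)

lemma run_cost_eq_seg_sum:
  assumes "valid_run A N xs"
  shows "run_cost A xs = seg_sum (step_len (contents A N xs)) (occupied A N xs) 0 (Suc N)"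
proof -
  define L where "L = sort_key (place A xs) [0..<length xs]"
  define ps where "ps = 0 # map (\<lambda>i. Suc (place A xs i)) L @ [Suc N]"
  have L: "set L = {..<length xs}" "distinct L" "sorted (map (place A xs) L)"
    by (auto simp: L_def)
  have "distinct (map (place A xs) L)"
    using assms L by (simp add: distinct_map valid_run_def)
  then have "sorted_wrt (<) (map (place A xs) L)"
    using L(3) by (simp add: strict_sorted_iff)
  then have sorted: "sorted_wrt (<) ps"
    using assms L(1) by (auto simp: ps_def sorted_wrt_append sorted_wrt_map valid_run_def)
  have "map (contents A N xs) ps = 0 # map (\<lambda>i. xs ! i) L @ [1]"
    using contents_place[OF assms] L(1) by (simp add: ps_def)
  then have "run_cost A xs = path_cost (map (contents A N xs) ps)"
    by (simp add: run_cost_def L_def)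
  also have "\<dots> = seg_sum (step_len (contents A N xs)) (set ps) (hd ps) (last ps)"
    by (rule path_cost_eq_seg_sum[OF sorted]) (simp add: ps_def)
  also have "set ps = occupied A N xs"
    using L(1) by (auto simp: ps_def occupied_def)
  finally show ?thesis by (simp add: ps_def)
qed

text \<open>By the triangle inequality, later reals never lower the cost, so the bound on the final
  cost holds after every phase as well.\<close>

lemma prefix_cost_le:
  assumes "valid_run A N (xs @ ys)"
  shows "seg_sum (step_len (contents A N xs)) (occupied A N xs) 0 (Suc N) \<le> run_cost A (xs @ ys)"
proof -
  let ?D = "occupied A N xs" and ?D' = "occupied A N (xs @ ys)" and ?f = "contents A N (xs @ ys)"
  have "seg_sum (step_len (contents A N xs)) ?D 0 (Suc N) \<le> seg_sum (seg_sum (step_len ?f) ?D') ?D 0 (Suc N)"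
  proof (rule seg_sum_mono)
    fix u v assume uv: "(u, v) \<in> seg ?D 0 (Suc N)"
    have "step_len (contents A N xs) u v = step_len ?f u v"
      using contents_append[OF assms] segD(1,2)[OF uv] by simp
    also have "\<dots> \<le> seg_sum (step_len ?f) ?D' u v"
      by (rule step_len_le_seg_sum) (use segD[OF uv] occupied_append[of A N xs ys] in auto)
    finally show "step_len (contents A N xs) u v \<le> seg_sum (step_len ?f) ?D' u v" .
  qed
  also have "\<dots> = seg_sum (step_len ?f) ?D' 0 (Suc N)"
    by (rule seg_sum_refine[symmetric]) (use occupied_append in \<open>auto simp: occupied_def\<close>)
  finally show ?thesis by (simp add: run_cost_eq_seg_sum[OF assms])
qed

section \<open>The phases in succession\<close>

lemma length_filter_concat_replicate:
  "p \<in> set ps \<Longrightarrow> m \<le> length (filter ((=) p) (concat (map (replicate m) ps)))"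
  by (induction ps) (auto simp: trans_le_add2)

lemma length_concat_replicate: "length (concat (map (replicate m) ps)) = length ps * m"
  by (induction ps) auto

text \<open>Each of \<open>T\<close> phases gains \<open>1 / (1024 * \<gamma>)\<close>, while the
  final potential is at most \<open>2 * \<Delta> + T / (2048 * \<gamma>)\<close>. The size of
  \<open>n\<close> guarantees at least one copy of every point even in the finest phase.\<close>

lemma competitive_lower_bound:
  assumes n: "0 < T" "T * (24576 * T ^ 5) ^ T \<le> n"
    and g: "1 \<le> \<gamma>" "1 \<le> \<Delta>" and comp: "admits_competitive \<gamma> n \<Delta>"
  shows "real T \<le> 4096 * (\<gamma> * \<Delta>)"
proof (cases "real T \<le> \<gamma> \<or> real T \<le> \<Delta>")
  case True
  have "\<gamma> * 1 \<le> \<gamma> * \<Delta>" "1 * \<Delta> \<le> \<gamma> * \<Delta>" using g by (intro mult_mono; simp)+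
  then show ?thesis using True g by linarith
next
  case False
  then have gT: "\<gamma> \<le> real T" "\<Delta> \<le> real T" by auto
  define N where "N = num_cells \<gamma> n"
  \<comment> \<open>This is the ratio \<open>\<theta>' / \<theta>\<close> within a phase
    (\<open>24576 = 16 * 1536\<close>). Shrinking \<open>J\<close> by the factor \<open>k\<close>
    makes the upper threshold of a phase the lower one of the next.\<close>
  define k where "k = 24576 * T ^ 5"
  define c where "c = 9 * real T / (36864 * \<gamma>\<^sup>2 * real n)"
  define \<theta> where "\<theta> = (\<lambda>l. real n * real k ^ l / (1536 * real T ^ 4 * real k ^ (T - 1)))"
  define Z where "Z = (\<lambda>A l xs. seg_sum (gap_weight (\<theta> l) c (contents A N xs)) (occupied A N xs) 0 (Suc N))"
  have k0: "0 < k" using n by (simp add: k_def)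
  have nk: "T * k ^ T \<le> n" using n by (simp add: k_def)
  have n0: "0 < n" using nk n k0 by (metis gr0I le_zero_eq mult_is_0 not_gr_zero power_not_zero)
  have c0: "0 \<le> c" using g by (simp add: c_def)
  have M: "real (Suc N) \<le> 2 * \<gamma> * real n"
  proof -
    have "1 * 1 \<le> \<gamma> * real n" using g n0 by (intro mult_mono) auto
    moreover have "real N \<le> \<gamma> * real n" using g by (simp add: N_def num_cells_def)
    ultimately show ?thesis by simp
  qed
  obtain A where A: "\<And>xs. length xs = n \<Longrightarrow> set xs \<subseteq> {0..1} \<Longrightarrow> valid_run A N xs \<and> run_cost A xs \<le> \<Delta>"
    using comp by (auto simp: admits_competitive_def N_def)
  have pre: "valid_run A N xs" "seg_sum (step_len (contents A N xs)) (occupied A N xs) 0 (Suc N) \<le> \<Delta>"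
    if "length xs \<le> n" "set xs \<subseteq> {0..1}" for xs
  proof -
    \<comment> \<open>Competitiveness speaks of full streams only; padding with zeros transfers it
      to prefixes.\<close>
    let ?ys = "replicate (n - length xs) (0::real)"
    have "valid_run A N (xs @ ?ys) \<and> run_cost A (xs @ ?ys) \<le> \<Delta>"
      by (rule A) (use that in auto)
    then show "valid_run A N xs" "seg_sum (step_len (contents A N xs)) (occupied A N xs) 0 (Suc N) \<le> \<Delta>"
      using valid_run_appendD[of A N xs ?ys] prefix_cost_le[of A N xs ?ys] by auto
  qed
  \<comment> \<open>Each phase consumes at most \<open>n / T\<close> reals; the multiplied form of
    this budget avoids division.\<close>
  have "\<exists>xs. set xs \<subseteq> {0..1} \<and> T * length xs \<le> l * n \<and> real l / (1024 * \<gamma>) \<le> Z A l xs" if "l \<le> T" for l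
    using that
  proof (induction l)
    case 0
    have "0 \<le> Z A 0 []"
      unfolding Z_def by (rule seg_sum_nonneg) (use c0 in \<open>auto simp: gap_weight_def\<close>)
    then show ?case by (intro exI[of _ "[]"]) simp
  next
    case (Suc l)
    then obtain xs where xs: "set xs \<subseteq> {0..1}" "T * length xs \<le> l * n" "real l / (1024 * \<gamma>) \<le> Z A l xs" by auto
    define J where "J = k ^ (T - 1 - l)"
    define m where "m = n div (T * J)"
    have J0: "0 < J" using k0 by (simp add: J_def)
    have Jl: "real J * real k ^ l = real k ^ (T - 1)"
      using Suc.prems by (simp add: J_def flip: power_add)
    have "J \<le> k ^ T" unfolding J_def by (rule power_increasing) (use k0 in auto)
    then have TJ: "T * J \<le> n" using nk by (meson le_trans mult_le_mono2)
    have m: "real n / (2 * real T * real J) \<le> real m"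
    proof -
      have "1 \<le> m" using TJ n J0 by (simp add: m_def div_greater_zero_iff Suc_le_eq)
      moreover have "n < T * J * (m + 1)"
        using dividend_less_times_div[of "T * J" n] n J0 by (simp add: m_def)
      \<comment> \<open>Rounding down loses at most a factor 2 because \<open>m\<close> is at least
        1.\<close>
      ultimately have "n \<le> T * J * (2 * m)"
        by (metis add_mono_thms_linordered_semiring(1) less_imp_le mult_2 mult_le_mono2 order_refl order_trans)
      then have "real n \<le> real (T * J * (2 * m))" by (simp only: of_nat_le_iff)
      then show ?thesis using n J0 by (simp add: field_simps)
    qed
    have th: "\<theta> l = real n / (1536 * real T ^ 4 * real J)"
      unfolding \<theta>_def Jl[symmetric] using k0 by simp
    have th': "\<theta> (Suc l) = 16 * real T * real n / real J"
    proof -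
      have "\<theta> (Suc l) = real k * \<theta> l" by (simp add: \<theta>_def)
      also have "\<dots> = 16 * real T * real n / real J"
        unfolding th k_def using n J0 by (simp add: field_simps power_numeral_reduce)
      finally show ?thesis .
    qed
    obtain q where q: "q < 192 * T\<^sup>2" and gain: "\<And>D' f'. occupied A N xs \<subseteq> D' \<Longrightarrow> D' \<subseteq> {0..Suc N} \<Longrightarrow>
        (\<forall>z\<in>occupied A N xs. f' z = contents A N xs z) \<Longrightarrow>
        (\<forall>p\<in>lattice (192 * T\<^sup>2) J q. m \<le> card {z \<in> D' - occupied A N xs. f' z = p}) \<Longrightarrow>
        seg_sum (step_len f') D' 0 (Suc N) \<le> \<Delta> \<Longrightarrow>
        seg_sum (gap_weight (\<theta> l) c (contents A N xs)) (occupied A N xs) 0 (Suc N) + 1 / (1024 * \<gamma>)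
          \<le> seg_sum (gap_weight (\<theta> (Suc l)) c f') D' 0 (Suc N)"
      using phase_gain[OF n(1) n0 J0 g(1) gT M m _ _ th th' c_def, of "occupied A N xs" "contents A N xs"]
      by (auto simp: occupied_def)
    define ps where "ps = sorted_list_of_set (lattice (192 * T\<^sup>2) J q)"
    define ys where "ys = concat (map (replicate m) ps)"
    have ps: "set ps = lattice (192 * T\<^sup>2) J q" "length ps = J"
      by (simp_all add: ps_def lattice_card)
    have "set ys \<subseteq> set ps" by (auto simp: ys_def)
    then have ys01: "set ys \<subseteq> {0..1}" using lattice_bounds[OF q] ps by auto
    have "T * length ys \<le> n"
      using div_times_less_eq_dividend[of n "T * J"]
      by (simp add: ys_def length_concat_replicate ps m_def mult.assoc mult.commute mult.left_commute)
    then have len: "T * length (xs @ ys) \<le> Suc l * n" using xs(2) by (simp add: algebra_simps)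
    also have "\<dots> \<le> T * n" using Suc.prems by (rule mult_le_mono1)
    finally have "length (xs @ ys) \<le> n" using n by simp
    then have v: "valid_run A N (xs @ ys)"
      and cost: "seg_sum (step_len (contents A N (xs @ ys))) (occupied A N (xs @ ys)) 0 (Suc N) \<le> \<Delta>"
      using pre[of "xs @ ys"] xs(1) ys01 by auto
    have "Z A l xs + 1 / (1024 * \<gamma>) \<le> Z A (Suc l) (xs @ ys)"
      unfolding Z_def
    proof (rule gain)
      show "\<forall>p\<in>lattice (192 * T\<^sup>2) J q. m \<le> card {z \<in> occupied A N (xs @ ys) - occupied A N xs. contents A N (xs @ ys) z = p}"
      proof
        fix p assume "p \<in> lattice (192 * T\<^sup>2) J q"
        then have "m \<le> length (filter ((=) p) ys)"
          unfolding ys_def by (intro length_filter_concat_replicate) (simp add: ps)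
        also note count_copies[OF v]
        finally show "m \<le> card {z \<in> occupied A N (xs @ ys) - occupied A N xs. contents A N (xs @ ys) z = p}" .
      qed
    qed (use occupied_append occupied_subset[OF v] contents_append[OF v] cost in auto)
    then have "real (Suc l) / (1024 * \<gamma>) \<le> Z A (Suc l) (xs @ ys)"
      using xs(3) by (simp add: add_divide_distrib)
    then show ?case using len xs(1) ys01 by (intro exI[of _ "xs @ ys"]) auto
  qed
  from this[of T] obtain xs where xs: "set xs \<subseteq> {0..1}" "T * length xs \<le> T * n" "real T / (1024 * \<gamma>) \<le> Z A T xs"
    by auto
  have "length xs \<le> n" using xs(2) n by simp
  then have cost: "seg_sum (step_len (contents A N xs)) (occupied A N xs) 0 (Suc N) \<le> \<Delta>"
    using pre xs(1) by blast
  \<comment> \<open>Treating every gap as short bounds the potential by twice the cost plus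
    \<open>c\<close> times the whole array length.\<close>
  have "Z A T xs \<le> seg_sum (\<lambda>u v. 2 * step_len (contents A N xs) u v + c * real (v - u)) (occupied A N xs) 0 (Suc N)"
    unfolding Z_def by (rule seg_sum_mono) (use c0 in \<open>auto simp: gap_weight_def\<close>)
  also have "\<dots> = 2 * seg_sum (step_len (contents A N xs)) (occupied A N xs) 0 (Suc N) + c * real (Suc N - 0)"
    using seg_sum_length[of 0 "occupied A N xs" "Suc N"]
    by (simp only: seg_sum_plus seg_sum_cmult) (simp add: occupied_def)
  also have "\<dots> \<le> 2 * \<Delta> + c * (2 * \<gamma> * real n)"
    using cost M c0 by (intro add_mono mult_left_mono) auto
  also have "c * (2 * \<gamma> * real n) = real T / (2048 * \<gamma>)"
    using g n0 by (simp add: c_def field_simps power2_eq_square)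
  finally have "real T / (1024 * \<gamma>) \<le> 2 * \<Delta> + real T / (2048 * \<gamma>)" using xs(3) by linarith
  then show ?thesis using g by (simp add: field_simps)
qed

section \<open>The number of phases that fit into a stream of length n\<close>

theorem theorem1:
  shows "\<exists>c::real. c > 0 \<and> (\<exists>n0::nat. \<forall>n\<ge>n0. \<forall>\<gamma> \<Delta>::real.
           \<gamma> \<ge> 1 \<longrightarrow> \<Delta> \<ge> 1 \<longrightarrow> admits_competitive \<gamma> n \<Delta> \<longrightarrow>
           \<gamma> * \<Delta> \<ge> c * (ln (real n) / ln (ln (real n))))"
proof -
  have lim: "filterlim (\<lambda>n::nat. ln (real n)) at_top sequentially"
    by (rule filterlim_compose[OF ln_at_top filterlim_real_sequentially])
  \<comment> \<open>From 84 on, \<open>21 * L \<le> (L / 2) * (L / 2)\<close>, which makes the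
    number of phases at least 1.\<close>
  have "eventually (\<lambda>n::nat. 84 \<le> ln (ln (real n)) \<and> 1 \<le> ln (real n)) sequentially"
    using filterlim_compose[OF ln_at_top lim] lim by (auto simp: filterlim_at_top intro: eventually_conj)
  then obtain n0 where n0: "\<And>n. n \<ge> n0 \<Longrightarrow> 84 \<le> ln (ln (real n)) \<and> 1 \<le> ln (real n)"
    by (auto simp: eventually_sequentially)
  \<comment> \<open>\<open>172032 = 21 * 8192\<close>, where 8192 is 4096 doubled to undo the
    rounding of \<open>R\<close> to \<open>T\<close>.\<close>
  have "1 / 172032 * (ln (real n) / ln (ln (real n))) \<le> \<gamma> * \<Delta>"
    if n: "n \<ge> n0" and g: "1 \<le> \<gamma>" "1 \<le> \<Delta>" "admits_competitive \<gamma> n \<Delta>" for n \<gamma> \<Delta>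
  proof -
    define L where "L = ln (ln (real n))"
    \<comment> \<open>The logarithm of the required stream length is at most
      \<open>T * (1 + 15 + 5) * L\<close>: 1 for the leading factor \<open>T\<close>, 15 for the
      constant 24576 and 5 for the exponent of \<open>T\<close>.\<close>
    define R where "R = ln (real n) / (21 * L)"
    define T where "T = nat \<lfloor>R\<rfloor>"
    have L84: "84 \<le> L" and ln1: "1 \<le> ln (real n)" using n0[OF n] by (auto simp: L_def)
    have n1: "0 < n" using ln1 by (cases "n = 0") auto
    have "21 * L \<le> (L / 2) * (L / 2)" using L84 by (simp add: field_simps)
    also have "\<dots> \<le> exp (L / 2) * exp (L / 2)"
    proof -
      have "L / 2 \<le> exp (L / 2)" using exp_ge_add_one_self[of "L / 2"] by linarith
      then show ?thesis using L84 by (intro mult_mono) auto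
    qed
    also have "\<dots> = ln (real n)" using ln1 by (simp add: L_def flip: exp_add)
    finally have L: "1 \<le> L" "21 * L \<le> ln (real n)" "1 \<le> ln (real n)" using L84 ln1 by auto
    have R: "1 \<le> R" using L by (simp add: R_def field_simps)
    have "1 \<le> \<lfloor>R\<rfloor>" using R by simp
    then have "real T = of_int \<lfloor>R\<rfloor>" "1 \<le> real T" by (simp_all add: T_def)
    then have T: "real T \<le> R" "R \<le> 2 * real T" "0 < T" using R by linarith+
    have "R \<le> ln (real n) / 1" unfolding R_def by (rule divide_left_mono) (use L in auto)
    then have "ln (real T) \<le> L" using T L by (simp add: L_def)
    have "ln (24576::real) \<le> ln (2 ^ 15)" by (subst ln_le_cancel_iff) auto
    also have "\<dots> = 15 * ln 2" by (simp only: ln_realpow zero_less_numeral of_nat_numeral)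
    also have "\<dots> \<le> 15" using ln_le_minus_one[of 2] by simp
    finally have ln_const: "ln (24576::real) \<le> 15" .
    have "ln (real (T * (24576 * T ^ 5) ^ T)) = ln (real T) + real T * (ln 24576 + 5 * ln (real T))"
      using T by (simp add: ln_mult ln_realpow distrib_left)
    also have "\<dots> \<le> L + real T * (15 + 5 * L)"
      using \<open>ln (real T) \<le> L\<close> ln_const by (intro add_mono mult_left_mono) auto
    also have "\<dots> \<le> real T * L + real T * (15 * L + 5 * L)"
      using T L by (intro add_mono mult_left_mono) (auto simp: Suc_le_eq)
    also have "\<dots> = real T * (21 * L)" by (simp add: algebra_simps)
    also have "\<dots> \<le> R * (21 * L)" using T L by (intro mult_right_mono) auto
    also have "\<dots> = ln (real n)" using L by (simp add: R_def)
    finally have "real (T * (24576 * T ^ 5) ^ T) \<le> real n"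
      using T n1 by (subst (asm) ln_le_cancel_iff) auto
    then have "real T \<le> 4096 * (\<gamma> * \<Delta>)"
      using competitive_lower_bound[OF T(3) _ g] by (simp only: of_nat_le_iff)
    then have "R \<le> 8192 * (\<gamma> * \<Delta>)" using T by linarith
    then show ?thesis by (simp add: R_def L_def)
  qed
  then show ?thesis by (intro exI[of _ "1 / 172032"] conjI exI[of _ n0]) auto
qed

end
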